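(* Let $\mathbb{S}$ and $\mathbb{T}$ be algebraic theories such that: (S1) for all $\mathbb S$-terms $s',s''$: if $\emptyset\vdash s'$ and $\Gamma\vdash s'=_{\mathbb S} s''$ then $\emptyset\vdash s''$; (S2) for every $\mathbb S$-term $s'$ and variable $x$: if $\Gamma\vdash s'=_{\mathbb S}x$ then $\{x\}\vdash s'$; (S4) for every $\mathbb S$-term $s'$ with at least one variable there is a substitution $f$ from $\mathrm{var}(s')$ to $\mathbb S$-terms such that for every $x\in\mathrm{var}(s')$, $s'[f(y)/y\neq x]=_{\mathbb S}x$; (T2) for all $\mathbb T$-terms $t',t''$: if $\emptyset\vdash t'$ and $\Gamma\vdash t'=_{\mathbb T}t''$ then $\emptyset\vdash t''$; (T3) for every $\mathbb T$-term $t'$ and variable $x$: if $\Gamma\vdash t'=_{\mathbb T}x$ then $\{x\}\vdash t'$; (T4) $\mathbb T$ has a constant $e_{\mathbb T}$. Suppose there are terms $2\vdash_{\mathbb S}s$ and $2\vdash_{\mathbb T}t$ and constants $e_s$ of $\mathbb S$ and $e_t$ of $\mathbb T$ with $s(x,e_s)=_{\mathbb S}x=_{\mathbb S}s(e_s,x)$ and $t(x,e_t)=_{\mathbb T}x=_{\mathbb T}t(e_t,x)$, and suppose moreover that $t$ does not satisfy the abides equation, in the sense that for all variables $x,y,z,w$: if $\Gamma\vdash t(t(x,y),t(z,w)) =_{\mathbb T} t(t(x,z),t(y,w))$ then at most three of $x,y,z,w$ are distinct. Then there does not exist a composite theory of $\mathbb{T}$ after $\mathbb{S}$.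
   Context: An algebraic theory consists of a signature and equations; $=_{\mathbb T}$ is provable equality. $\mathrm{var}(t)$ is the set of variables of $t$; $Y\vdash t$ means $\mathrm{var}(t)\subseteq Y$; $\Gamma$ is an arbitrary context; a constant is a $0$-ary operation. $s'[f(y)/y\neq x]$ substitutes $f(y)$ for every variable $y\neq x$ of $s'$. For theories $\mathbb{S},\mathbb{T}$: $\mathbb{U}$ contains them if its signature contains both signatures and their equations are provable in $\mathbb{U}$; a separated term is $t[s_x/x]$ (simultaneous substitution) with $t$ a $\mathbb{T}$-term with variables in $X$ and $s_x$ $\mathbb{S}$-terms; separated terms $t[s_x/x]$, $t'[s'_{x'}/x']$ are equal modulo $(\mathbb{T},\mathbb{S})$ if there are $f:X\to Y$, $f':X'\to Y$ and $\mathbb{S}$-terms $\bar s_y$ with $t[f(x)/x]=_{\mathbb T}t'[f'(x')/x']$, $s_x=_{\mathbb S}\bar s_{f(x)}$, $s'_{x'}=_{\mathbb S}\bar s_{f'(x')}$; $\mathbb{U}$ is a composite theory of $\mathbb{T}$ after $\mathbb{S}$ if every $\mathbb U$-term is $\mathbb U$-equal to a separated term and any two separated terms $\mathbb U$-equal to a common term are equal modulo $(\mathbb{T},\mathbb{S})$. *)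

theory Defs
  imports Main
begin

datatype ('o, vars: 'v) trm = Var 'v | Op 'o "('o, 'v) trm list"

primrec subst :: "('o, 'v) trm \<Rightarrow> ('v \<Rightarrow> ('o, 'w) trm) \<Rightarrow> ('o, 'w) trm" (infixl "\<cdot>" 67) where
  "Var x \<cdot> \<sigma> = \<sigma> x"
| "Op f ts \<cdot> \<sigma> = Op f (map (\<lambda>t. t \<cdot> \<sigma>) ts)"

text \<open>
  An operation symbol is a name together with its arity, so that inclusion of signatures
  preserves arities. The type of names \<open>'o\<close> is an arbitrary universe from which the signatures
  of all theories under consideration are drawn. Terms are finite, so a countable supply of
  variables suffices.
\<close>

record 'o alg_theory =
  sig :: "('o \<times> nat) set"
  eqs :: "(('o, nat) trm \<times> ('o, nat) trm) set"

fun over :: "('o \<times> nat) set \<Rightarrow> ('o, 'v) trm \<Rightarrow> bool" where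
  "over \<Sigma> (Var x) \<longleftrightarrow> True"
| "over \<Sigma> (Op f ts) \<longleftrightarrow> (f, length ts) \<in> \<Sigma> \<and> (\<forall>t \<in> set ts. over \<Sigma> t)"

definition terms :: "'o alg_theory \<Rightarrow> nat set \<Rightarrow> ('o, nat) trm set" where
  "terms T Y = {t. over (sig T) t \<and> vars t \<subseteq> Y}"

definition algebraic_theory :: "'o alg_theory \<Rightarrow> bool" where
  "algebraic_theory T \<longleftrightarrow> (\<forall>(l, r) \<in> eqs T. l \<in> terms T UNIV \<and> r \<in> terms T UNIV)"

text \<open>
  Equational logic: \<open>deriv T \<Gamma> s t\<close> says that \<open>s = t\<close> is derivable from the equations of \<open>T\<close> in
  context \<open>\<Gamma>\<close>, that is, by a derivation in which all terms have their variables in \<open>\<Gamma>\<close>.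
  Closure under substitution is built into the axiom rule.
\<close>

inductive deriv :: "'o alg_theory \<Rightarrow> nat set \<Rightarrow> ('o, nat) trm \<Rightarrow> ('o, nat) trm \<Rightarrow> bool"
  for T :: "'o alg_theory" and \<Gamma> :: "nat set"
where
  ax: "(l, r) \<in> eqs T \<Longrightarrow> \<forall>x \<in> vars l \<union> vars r. \<sigma> x \<in> terms T \<Gamma> \<Longrightarrow> deriv T \<Gamma> (l \<cdot> \<sigma>) (r \<cdot> \<sigma>)"
| refl: "t \<in> terms T \<Gamma> \<Longrightarrow> deriv T \<Gamma> t t"
| sym: "deriv T \<Gamma> s t \<Longrightarrow> deriv T \<Gamma> t s"
| trans: "deriv T \<Gamma> s t \<Longrightarrow> deriv T \<Gamma> t u \<Longrightarrow> deriv T \<Gamma> s u"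
| cong: "(f, length ss) \<in> sig T \<Longrightarrow> list_all2 (deriv T \<Gamma>) ss ts \<Longrightarrow> deriv T \<Gamma> (Op f ss) (Op f ts)"

abbreviation deriv_syntax ("(_ \<turnstile>/ _ \<approx>\<^bsub>_\<^esub>/ _)" [51, 51, 0, 51] 50) where
  "\<Gamma> \<turnstile> s \<approx>\<^bsub>T\<^esub> t \<equiv> deriv T \<Gamma> s t"

definition prov_eq :: "('o, nat) trm \<Rightarrow> 'o alg_theory \<Rightarrow> ('o, nat) trm \<Rightarrow> bool"
    ("(_ =\<^bsub>_\<^esub>/ _)" [51, 0, 51] 50) where
  "s =\<^bsub>T\<^esub> t \<longleftrightarrow> (\<exists>\<Gamma>. \<Gamma> \<turnstile> s \<approx>\<^bsub>T\<^esub> t)"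

definition contains :: "'o alg_theory \<Rightarrow> 'o alg_theory \<Rightarrow> bool" where
  "contains U T \<longleftrightarrow> sig T \<subseteq> sig U \<and> (\<forall>(l, r) \<in> eqs T. l =\<^bsub>U\<^esub> r)"

text \<open>
  A separated term is handled through its decomposition \<open>X\<close>, \<open>t\<close>, \<open>(s x)\<close> for \<open>x \<in> X\<close>, since
  equality modulo \<open>(T, S)\<close> refers to the decomposition; the term itself is \<open>t \<cdot> s\<close>.
\<close>

definition separated ::
  "'o alg_theory \<Rightarrow> 'o alg_theory \<Rightarrow> nat set \<Rightarrow> ('o, nat) trm \<Rightarrow> (nat \<Rightarrow> ('o, nat) trm) \<Rightarrow> bool" where
  "separated T S X t s \<longleftrightarrow> t \<in> terms T X \<and> (\<forall>x \<in> X. s x \<in> terms S UNIV)"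

definition equal_modulo ::
  "'o alg_theory \<Rightarrow> 'o alg_theory \<Rightarrow>
   nat set \<Rightarrow> ('o, nat) trm \<Rightarrow> (nat \<Rightarrow> ('o, nat) trm) \<Rightarrow>
   nat set \<Rightarrow> ('o, nat) trm \<Rightarrow> (nat \<Rightarrow> ('o, nat) trm) \<Rightarrow> bool" where
  "equal_modulo T S X t s X' t' s' \<longleftrightarrow>
    (\<exists>Y f f' r. f ` X \<subseteq> Y \<and> f' ` X' \<subseteq> Y \<and> (\<forall>y \<in> Y. r y \<in> terms S UNIV) \<and>
       t \<cdot> (\<lambda>x. Var (f x)) =\<^bsub>T\<^esub> t' \<cdot> (\<lambda>x'. Var (f' x')) \<and>
       (\<forall>x \<in> X. s x =\<^bsub>S\<^esub> r (f x)) \<and> (\<forall>x' \<in> X'. s' x' =\<^bsub>S\<^esub> r (f' x')))"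

definition composite_theory :: "'o alg_theory \<Rightarrow> 'o alg_theory \<Rightarrow> 'o alg_theory \<Rightarrow> bool" where
  "composite_theory U T S \<longleftrightarrow>
    algebraic_theory U \<and> contains U S \<and> contains U T \<and>
    (\<forall>u \<in> terms U UNIV. \<exists>X t s. separated T S X t s \<and> u =\<^bsub>U\<^esub> t \<cdot> s) \<and>
    (\<forall>u \<in> terms U UNIV. \<forall>X t s X' t' s'.
       separated T S X t s \<and> separated T S X' t' s' \<and> t \<cdot> s =\<^bsub>U\<^esub> u \<and> t' \<cdot> s' =\<^bsub>U\<^esub> u \<longrightarrow>
       equal_modulo T S X t s X' t' s')"

definition is_constant :: "'o alg_theory \<Rightarrow> ('o, nat) trm \<Rightarrow> bool" where
  "is_constant T c \<longleftrightarrow> (\<exists>e. (e, 0) \<in> sig T \<and> c = Op e [])"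

text \<open>The context \<open>2\<close> is rendered as \<open>{0, 1}\<close>; \<open>app2 t a b\<close> is \<open>t(a, b)\<close>.\<close>

definition app2 :: "('o, nat) trm \<Rightarrow> ('o, nat) trm \<Rightarrow> ('o, nat) trm \<Rightarrow> ('o, nat) trm" where
  "app2 t a b = t \<cdot> Var(0 := a, 1 := b)"

end

theory Submission
  imports Defs
begin

text \<open>
  In a composite theory \<open>U\<close>, the term \<open>s\<close> distributes over \<open>t\<close> on both sides. Indeed, let
  \<open>v[q\<^sub>i]\<close> be a separated form of \<open>s(x, t(y, z))\<close>. Replacing \<open>x\<close> by \<open>e_s\<close> turns the left-hand
  side into \<open>t(y, z)\<close>, so by essential uniqueness and (T3) each \<open>q\<^sub>i\<close> becomes \<open>y\<close> or \<open>z\<close>, and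
  \<open>v\<close> becomes \<open>t\<close>. Replacing \<open>z\<close> by \<open>e_t\<close> turns the left-hand side into \<open>s(x, y)\<close> and kills
  every \<open>q\<^sub>i\<close> of the second kind, which identifies those of the first kind as \<open>s(x, y)\<close>.
  Expanding \<open>s(t(y\<^sub>0, y\<^sub>1), t(y\<^sub>2, y\<^sub>3))\<close> in both orders then gives two separated terms whose
  equality modulo \<open>(T, S)\<close> is an abides equation for \<open>t\<close> in four distinct variables.
\<close>

section \<open>Terms and simultaneous substitution\<close>

lemma vars_subst: "vars (t \<cdot> \<sigma>) = (\<Union>x \<in> vars t. vars (\<sigma> x))"
  by (induction t) auto

lemma subst_subst: "t \<cdot> \<sigma> \<cdot> \<tau> = t \<cdot> (\<lambda>x. \<sigma> x \<cdot> \<tau>)"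
  by (induction t) auto

lemma subst_cong: "(\<And>x. x \<in> vars t \<Longrightarrow> \<sigma> x = \<tau> x) \<Longrightarrow> t \<cdot> \<sigma> = t \<cdot> \<tau>"
  by (induction t) auto

lemma subst_Var [simp]: "t \<cdot> Var = t"
  by (induction t) (auto intro: map_idI)

lemma over_subst:
  "over \<Sigma> t \<Longrightarrow> (\<And>x. x \<in> vars t \<Longrightarrow> over \<Sigma> (\<sigma> x)) \<Longrightarrow> over \<Sigma> (t \<cdot> \<sigma>)"
  by (induction t) auto

lemma over_mono: "over \<Sigma> t \<Longrightarrow> \<Sigma> \<subseteq> \<Sigma>' \<Longrightarrow> over \<Sigma>' t"
  by (induction t) auto

lemma Var_in_terms [simp]: "Var x \<in> terms T Y \<longleftrightarrow> x \<in> Y"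
  by (simp add: terms_def)

lemma subst_in_terms:
  "t \<in> terms T X \<Longrightarrow> (\<And>x. x \<in> vars t \<Longrightarrow> \<sigma> x \<in> terms T Y) \<Longrightarrow> t \<cdot> \<sigma> \<in> terms T Y"
  unfolding terms_def by (auto simp: vars_subst intro!: over_subst)

lemma terms_contains: "contains U T \<Longrightarrow> t \<in> terms T Y \<Longrightarrow> t \<in> terms U Y"
  unfolding terms_def contains_def by (auto intro: over_mono)

lemma constant_subst: "is_constant T c \<Longrightarrow> c \<cdot> \<sigma> = c"
  by (auto simp: is_constant_def)

lemma constant_vars: "is_constant T c \<Longrightarrow> vars c = {}"
  by (auto simp: is_constant_def)

lemma constant_in_terms: "is_constant T c \<Longrightarrow> c \<in> terms T Y"
  by (auto simp: is_constant_def terms_def)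

text \<open>The bound on the variables of \<open>t\<close> matters: \<open>app2\<close> fixes every
  variable other than \<open>0\<close> and \<open>1\<close>, and \<open>\<sigma>\<close> would then
  move it on the left-hand side only.\<close>

lemma app2_subst:
  assumes "t \<in> terms T {0, 1}"
  shows "app2 t a b \<cdot> \<sigma> = app2 t (a \<cdot> \<sigma>) (b \<cdot> \<sigma>)"
  using assms unfolding app2_def subst_subst terms_def by (auto intro!: subst_cong)

lemma app2_in_terms:
  assumes "t \<in> terms T {0, 1}" "a \<in> terms T Y" "b \<in> terms T Y"
  shows "app2 t a b \<in> terms T Y"
proof -
  have "vars t \<subseteq> {0, 1}" using assms(1) by (simp add: terms_def)
  then show ?thesis
    unfolding app2_def using assms by (auto intro!: subst_in_terms[OF assms(1)])
qed

section \<open>Provable equality: substitution, congruence, passage to a larger theory\<close>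

lemma deriv_subst:
  assumes "\<Gamma> \<turnstile> a \<approx>\<^bsub>T\<^esub> b" and \<sigma>: "\<And>x. \<sigma> x \<in> terms T \<Delta>"
  shows "\<Delta> \<turnstile> a \<cdot> \<sigma> \<approx>\<^bsub>T\<^esub> b \<cdot> \<sigma>"
  using assms(1)
proof induction
  case (ax l r \<tau>)
  have "\<Delta> \<turnstile> l \<cdot> (\<lambda>x. \<tau> x \<cdot> \<sigma>) \<approx>\<^bsub>T\<^esub> r \<cdot> (\<lambda>x. \<tau> x \<cdot> \<sigma>)"
    using ax \<sigma> by (intro deriv.ax) (auto intro: subst_in_terms)
  then show ?case by (simp add: subst_subst)
next
  case (refl t)
  then show ?case using \<sigma> by (auto intro: deriv.refl subst_in_terms)
next
  case (cong f ss ts)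
  then show ?case
    by (auto simp: list.rel_map intro!: deriv.cong elim: list.rel_mono_strong)
qed (auto intro: deriv.sym deriv.trans)

text \<open>Substituting \<open>Var\<close> carries a derivation from any context into
  \<open>UNIV\<close>, so transitivity never has to reconcile two contexts.\<close>

lemma prov_eq_iff: "a =\<^bsub>T\<^esub> b \<longleftrightarrow> UNIV \<turnstile> a \<approx>\<^bsub>T\<^esub> b"
  unfolding prov_eq_def using deriv_subst[where \<sigma> = Var and \<Delta> = UNIV] by fastforce

lemma prov_eq_refl: "t \<in> terms T Y \<Longrightarrow> t =\<^bsub>T\<^esub> t"
  unfolding prov_eq_def by (blast intro: deriv.refl)

lemma prov_eq_sym: "a =\<^bsub>T\<^esub> b \<Longrightarrow> b =\<^bsub>T\<^esub> a"
  unfolding prov_eq_def by (blast intro: deriv.sym)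

lemma prov_eq_trans [trans]: "a =\<^bsub>T\<^esub> b \<Longrightarrow> b =\<^bsub>T\<^esub> c \<Longrightarrow> a =\<^bsub>T\<^esub> c"
  unfolding prov_eq_iff by (rule deriv.trans)

lemma prov_eq_subst:
  assumes "a =\<^bsub>T\<^esub> b" and \<sigma>: "\<And>x. x \<in> vars a \<union> vars b \<Longrightarrow> \<sigma> x \<in> terms T UNIV"
  shows "a \<cdot> \<sigma> =\<^bsub>T\<^esub> b \<cdot> \<sigma>"
proof -
  \<comment> \<open>Intermediate terms of a derivation may contain further variables, where
    \<open>\<sigma>\<close> need not give a term of \<open>T\<close>; there \<open>\<tau>\<close>
    defaults to \<open>Var\<close>.\<close>
  define \<tau> where "\<tau> x = (if x \<in> vars a \<union> vars b then \<sigma> x else Var x)" for x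
  have "a \<cdot> \<tau> =\<^bsub>T\<^esub> b \<cdot> \<tau>"
    using assms unfolding prov_eq_iff \<tau>_def by (auto intro!: deriv_subst)
  moreover have "a \<cdot> \<tau> = a \<cdot> \<sigma>" "b \<cdot> \<tau> = b \<cdot> \<sigma>"
    by (auto simp: \<tau>_def intro!: subst_cong)
  ultimately show ?thesis by simp
qed

lemma prov_eq_subst_cong:
  assumes "t \<in> terms T Y" and "\<And>x. x \<in> vars t \<Longrightarrow> \<sigma> x =\<^bsub>T\<^esub> \<tau> x"
  shows "t \<cdot> \<sigma> =\<^bsub>T\<^esub> t \<cdot> \<tau>"
  using assms unfolding prov_eq_iff
proof (induction t)
  case (Op f ts)
  then have "list_all2 (deriv T UNIV) (map (\<lambda>t. t \<cdot> \<sigma>) ts) (map (\<lambda>t. t \<cdot> \<tau>) ts)"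
    by (fastforce simp: list.rel_map terms_def intro: list.rel_refl_strong)
  then show ?case using Op.prems by (auto simp: terms_def intro: deriv.cong)
qed auto

lemma prov_eq_app2:
  assumes "t \<in> terms T {0, 1}" "a =\<^bsub>T\<^esub> a'" "b =\<^bsub>T\<^esub> b'"
  shows "app2 t a b =\<^bsub>T\<^esub> app2 t a' b'"
proof -
  have "vars t \<subseteq> {0, 1}" using assms(1) by (simp add: terms_def)
  then show ?thesis
    unfolding app2_def using assms by (auto intro!: prov_eq_subst_cong[OF assms(1)])
qed

lemma prov_eq_contains:
  assumes U: "contains U T" and "a =\<^bsub>T\<^esub> b"
  shows "a =\<^bsub>U\<^esub> b"
proof -
  have "UNIV \<turnstile> a \<approx>\<^bsub>T\<^esub> b" using assms(2) by (simp add: prov_eq_iff)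
  then show ?thesis
  proof induction
    case (ax l r \<sigma>)
    then have "l =\<^bsub>U\<^esub> r" using U by (auto simp: contains_def)
    then show ?case
      using ax by (auto intro!: prov_eq_subst terms_contains[OF U])
  next
    case (refl t)
    then show ?case by (blast intro: prov_eq_refl terms_contains[OF U])
  next
    case (cong f ss ts)
    then have "(f, length ss) \<in> sig U" using U by (auto simp: contains_def)
    then show ?case
      using cong(2) unfolding prov_eq_iff
      by (auto intro!: deriv.cong elim: list.rel_mono_strong)
  qed (blast intro: prov_eq_sym prov_eq_trans)+
qed

section \<open>Separated forms in a composite theory\<close>

text \<open>The terms \<open>s\<close> and \<open>t\<close> are not fixed here, so that
  \<open>distributive\<close> can be used both for \<open>s\<close> and for \<open>s\<close> with
  its arguments exchanged.\<close>

locale composite =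
  fixes S T U :: "'o alg_theory" and e_s e_t :: "('o, nat) trm"
  assumes composite: "composite_theory U T S"
    and S2: "\<And>u x. u \<in> terms S UNIV \<Longrightarrow> u =\<^bsub>S\<^esub> Var x \<Longrightarrow> vars u \<subseteq> {x}"
    and T2: "\<And>u v. u \<in> terms T UNIV \<Longrightarrow> v \<in> terms T UNIV \<Longrightarrow> vars u = {} \<Longrightarrow>
               u =\<^bsub>T\<^esub> v \<Longrightarrow> vars v = {}"
    and T3: "\<And>u x. u \<in> terms T UNIV \<Longrightarrow> u =\<^bsub>T\<^esub> Var x \<Longrightarrow> vars u \<subseteq> {x}"
    and e_s: "is_constant S e_s" and e_t: "is_constant T e_t"
begin

lemma US: "contains U S" and UT: "contains U T"
  using composite by (auto simp: composite_theory_def)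

lemmas terms_US = terms_contains[OF US] and terms_UT = terms_contains[OF UT]
lemmas eq_US = prov_eq_contains[OF US] and eq_UT = prov_eq_contains[OF UT]

lemma Var_eq_S: "Var x =\<^bsub>S\<^esub> Var y \<Longrightarrow> x = y"
  using S2[of "Var x" y] by simp

lemma ex_separated:
  assumes "u \<in> terms U UNIV"
  shows "\<exists>v X q. v \<in> terms T X \<and> (\<forall>i \<in> X. q i \<in> terms S UNIV) \<and> u =\<^bsub>U\<^esub> v \<cdot> q"
  using composite assms unfolding composite_theory_def separated_def by blast

text \<open>Essential uniqueness with \<open>v' \<cdot> q'\<close> itself as the common
  term.\<close>

lemma separated_unique:
  assumes v: "v \<in> terms T X" "\<And>i. i \<in> X \<Longrightarrow> q i \<in> terms S UNIV"
    and v': "v' \<in> terms T X'" "\<And>i. i \<in> X' \<Longrightarrow> q' i \<in> terms S UNIV"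
    and eq: "v \<cdot> q =\<^bsub>U\<^esub> v' \<cdot> q'"
  shows "\<exists>f f' r. v \<cdot> (\<lambda>x. Var (f x)) =\<^bsub>T\<^esub> v' \<cdot> (\<lambda>x. Var (f' x)) \<and>
    (\<forall>i \<in> X. q i =\<^bsub>S\<^esub> r (f i)) \<and> (\<forall>i \<in> X'. q' i =\<^bsub>S\<^esub> r (f' i))"
proof -
  have sep: "separated T S X v q" "separated T S X' v' q'"
    using v v' by (auto simp: separated_def)
  have "vars v' \<subseteq> X'" using v'(1) by (simp add: terms_def)
  then have u: "v' \<cdot> q' \<in> terms U UNIV"
    using v'(2) by (blast intro: subst_in_terms[OF terms_UT[OF v'(1)]] terms_US)
  have "equal_modulo T S X v q X' v' q'"
    using composite sep eq u prov_eq_refl[OF u] unfolding composite_theory_def by blast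
  then show ?thesis unfolding equal_modulo_def by blast
qed

lemma upd_e_s_in_terms: "(Var(x := e_s)) y \<in> terms S UNIV"
  using e_s by (auto intro: constant_in_terms)

lemma upd_e_t_in_terms: "(Var(x := e_t)) y \<in> terms T UNIV"
  using e_t by (auto intro: constant_in_terms)

section \<open>Distributivity of \<open>s\<close> over \<open>t\<close>\<close>

text \<open>Let \<open>v \<cdot> p\<close> be a separated form of \<open>q\<close> with
  \<open>e_t\<close> for \<open>z\<close>. Putting \<open>e_s\<close> for \<open>x\<close> as well
  yields \<open>e_t\<close>, so uniqueness and (T2) make \<open>v\<close> closed. Then
  \<open>v \<cdot> p\<close> was not affected by putting \<open>e_s\<close> for \<open>x\<close>,
  and equals \<open>e_t\<close> already.\<close>

lemma subst_e_t_zero: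
  assumes q: "q \<in> terms S UNIV" and eq: "q \<cdot> Var(x := e_s) =\<^bsub>S\<^esub> Var z" and "x \<noteq> z"
  shows "q \<cdot> Var(z := e_t) =\<^bsub>U\<^esub> e_t"
proof -
  have "q \<cdot> Var(z := e_t) \<in> terms U UNIV"
    by (rule subst_in_terms[OF terms_US[OF q] terms_UT[OF upd_e_t_in_terms]])
  then obtain v X p where v: "v \<in> terms T X" "\<And>i. i \<in> X \<Longrightarrow> p i \<in> terms S UNIV"
    and vp: "q \<cdot> Var(z := e_t) =\<^bsub>U\<^esub> v \<cdot> p"
    using ex_separated by blast
  let ?p = "\<lambda>i. p i \<cdot> Var(x := e_s)"
  have "e_t = Var z \<cdot> Var(z := e_t)" by simp
  also have "\<dots> =\<^bsub>U\<^esub> q \<cdot> Var(x := e_s) \<cdot> Var(z := e_t)"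
    using prov_eq_sym[OF eq_US[OF eq]] by (rule prov_eq_subst) (rule terms_UT[OF upd_e_t_in_terms])
  \<comment> \<open>The two substitutions commute, because \<open>x\<close> and \<open>z\<close>
    differ and both constants are closed.\<close>
  also have "\<dots> = q \<cdot> Var(z := e_t) \<cdot> Var(x := e_s)"
    unfolding subst_subst using \<open>x \<noteq> z\<close> constant_subst[OF e_s] constant_subst[OF e_t]
    by (intro subst_cong) auto
  also have "\<dots> =\<^bsub>U\<^esub> v \<cdot> p \<cdot> Var(x := e_s)"
    using vp by (rule prov_eq_subst) (rule terms_US[OF upd_e_s_in_terms])
  finally have et: "e_t =\<^bsub>U\<^esub> v \<cdot> ?p" by (simp only: subst_subst)
  have "?p i \<in> terms S UNIV" if "i \<in> X" for i
    by (rule subst_in_terms[OF v(2)[OF that] upd_e_s_in_terms])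
  \<comment> \<open>The constant \<open>e_t\<close> is a separated term with empty index set;
    \<open>Var\<close> only fills the place of its components.\<close>
  moreover have "e_t \<cdot> Var =\<^bsub>U\<^esub> v \<cdot> ?p" using et by simp
  ultimately obtain f f' where "e_t \<cdot> (\<lambda>x. Var (f x)) =\<^bsub>T\<^esub> v \<cdot> (\<lambda>x. Var (f' x))"
    using separated_unique[OF constant_in_terms[OF e_t] _ v(1), of "{}" Var ?p] by blast
  moreover have "v \<cdot> (\<lambda>x. Var (f' x)) \<in> terms T UNIV"
    by (rule subst_in_terms[OF v(1)]) simp
  ultimately have "vars (v \<cdot> (\<lambda>x. Var (f' x))) = {}"
    using T2[OF constant_in_terms[OF e_t]] constant_vars[OF e_t] constant_subst[OF e_t] by metis
  then have "vars v = {}" by (auto simp: vars_subst)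
  then have "v \<cdot> p = v \<cdot> ?p" by (intro subst_cong) auto
  then show ?thesis using prov_eq_trans[OF vp] prov_eq_sym[OF et] by simp
qed

text \<open>
  Here \<open>v[q\<^sub>i]\<close> plays the separated form of \<open>s(z, t(a, b))\<close> and \<open>c\<close> the term \<open>s(z, a)\<close>. The
  components that reduce to \<open>b\<close> vanish under \<open>b := e_t\<close>, and the others do not contain \<open>b\<close>.
\<close>

lemma component_eq:
  assumes v: "v \<in> terms T X" and q: "\<And>j. j \<in> X \<Longrightarrow> q j \<in> terms S UNIV"
    and c: "c \<in> terms S UNIV" and eq: "v \<cdot> q \<cdot> Var(b := e_t) =\<^bsub>U\<^esub> c"
    and ab: "a \<noteq> b" "z \<noteq> b"
    and all: "\<And>j. j \<in> vars v \<Longrightarrow>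
      q j \<cdot> Var(z := e_s) =\<^bsub>S\<^esub> Var a \<or> q j \<cdot> Var(z := e_s) =\<^bsub>S\<^esub> Var b"
    and i: "i \<in> vars v" "q i \<cdot> Var(z := e_s) =\<^bsub>S\<^esub> Var a"
  shows "q i =\<^bsub>S\<^esub> c"
proof -
  have vX: "vars v \<subseteq> X" using v by (simp add: terms_def)
  \<comment> \<open>Putting \<open>e_t\<close> for \<open>b\<close> may take \<open>q j\<close> out
    of the \<open>S\<close>-terms. Moving \<open>e_t\<close> into the \<open>T\<close>-part instead,
    at the components that reduce to \<open>b\<close>, keeps the term separated.\<close>
  define w where "w j = (if q j \<cdot> Var(z := e_s) =\<^bsub>S\<^esub> Var b then e_t else Var j)" for j
  have w: "v \<cdot> w \<in> terms T X"
    using vX e_t by (auto simp: w_def intro!: subst_in_terms[OF v] intro: constant_in_terms)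
  have "v \<cdot> (\<lambda>j. w j \<cdot> q) =\<^bsub>U\<^esub> v \<cdot> (\<lambda>j. q j \<cdot> Var(b := e_t))"
  proof (rule prov_eq_subst_cong[OF terms_UT[OF v]])
    fix j assume j: "j \<in> vars v"
    then have qj: "q j \<in> terms S UNIV" using q vX by blast
    show "w j \<cdot> q =\<^bsub>U\<^esub> q j \<cdot> Var(b := e_t)"
    proof (cases "q j \<cdot> Var(z := e_s) =\<^bsub>S\<^esub> Var b")
      case True
      then show ?thesis
        using subst_e_t_zero[OF qj True ab(2)] e_t by (simp add: w_def constant_subst prov_eq_sym)
    next
      case False
      have "q j \<cdot> Var(z := e_s) \<in> terms S UNIV"
        by (rule subst_in_terms[OF qj upd_e_s_in_terms])
      then have "vars (q j \<cdot> Var(z := e_s)) \<subseteq> {a}"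
        using False all[OF j] S2[of "q j \<cdot> Var(z := e_s)" a] by blast
      then have "b \<notin> vars (q j)" using ab by (fastforce simp: vars_subst UN_subset_iff)
      then have "q j \<cdot> Var(b := e_t) = q j \<cdot> Var" by (intro subst_cong) auto
      then show ?thesis using False terms_US[OF qj] by (simp add: w_def prov_eq_refl)
    qed
  qed
  also have "v \<cdot> (\<lambda>j. q j \<cdot> Var(b := e_t)) = v \<cdot> q \<cdot> Var(b := e_t)" by (simp add: subst_subst)
  also note eq
  \<comment> \<open>The \<open>S\<close>-term \<open>c\<close> is read as a separated term whose
    \<open>T\<close>-part is a single variable. Uniqueness and (T3) then send all variables of
    \<open>v \<cdot> w\<close> to \<open>g' 0\<close>.\<close>
  finally have "v \<cdot> w \<cdot> q =\<^bsub>U\<^esub> Var 0 \<cdot> (\<lambda>_. c)" by (simp add: subst_subst)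
  then obtain g g' r where gg': "v \<cdot> w \<cdot> (\<lambda>x. Var (g x)) =\<^bsub>T\<^esub> Var 0 \<cdot> (\<lambda>x. Var (g' x))"
    and r: "\<forall>j \<in> X. q j =\<^bsub>S\<^esub> r (g j)" "c =\<^bsub>S\<^esub> r (g' 0)"
    using separated_unique[OF w _ _ _ \<open>v \<cdot> w \<cdot> q =\<^bsub>U\<^esub> Var 0 \<cdot> (\<lambda>_. c)\<close>, of "{0}"] q c
    by auto
  have "vars (v \<cdot> w \<cdot> (\<lambda>x. Var (g x))) \<subseteq> {g' 0}"
    using gg' by (intro T3) (auto intro!: subst_in_terms[OF w])
  \<comment> \<open>Component \<open>i\<close> reduces to \<open>a\<close>, so by (S2) not to
    \<open>b\<close>; hence \<open>i\<close> still occurs in \<open>v \<cdot> w\<close>.\<close>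
  moreover have "w i = Var i"
    using prov_eq_trans[OF prov_eq_sym[OF i(2)], of "Var b"] Var_eq_S ab(1) by (auto simp: w_def)
  ultimately have "g i = g' 0" using i(1) by (force simp: vars_subst)
  then show ?thesis
    using prov_eq_trans[OF bspec[OF r(1), of i], of c] prov_eq_sym[OF r(2)] i(1) vX by auto
qed

text \<open>The generic instance \<open>?W\<close> in the variables \<open>0\<close>,
  \<open>1\<close>, \<open>2\<close> is treated first, since uniqueness speaks about variables;
  \<open>p\<close>, \<open>a\<close>, \<open>b\<close> are substituted at the end.\<close>

lemma distributive:
  assumes s: "s \<in> terms S {0, 1}" and t: "t \<in> terms T {0, 1}"
    and s_unit: "\<And>x. app2 s e_s (Var x) =\<^bsub>S\<^esub> Var x"
    and t_unit: "\<And>x. app2 t (Var x) e_t =\<^bsub>T\<^esub> Var x" "\<And>x. app2 t e_t (Var x) =\<^bsub>T\<^esub> Var x"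
    and pab: "p \<in> terms U UNIV" "a \<in> terms U UNIV" "b \<in> terms U UNIV"
  shows "app2 s p (app2 t a b) =\<^bsub>U\<^esub> app2 t (app2 s p a) (app2 s p b)"
proof -
  note sU = terms_US[OF s] and tU = terms_UT[OF t]
  let ?W = "app2 s (Var 0) (app2 t (Var 1) (Var 2))"
  let ?c = "\<lambda>a. app2 s (Var 0) (Var a)"
  have "?W \<in> terms U UNIV" by (intro app2_in_terms sU tU) auto
  then obtain v X q where v: "v \<in> terms T X" and q: "\<And>i. i \<in> X \<Longrightarrow> q i \<in> terms S UNIV"
    and Wq: "?W =\<^bsub>U\<^esub> v \<cdot> q" using ex_separated by blast
  have vX: "vars v \<subseteq> X" using v by (simp add: terms_def)
  let ?q = "\<lambda>i. q i \<cdot> Var(0 := e_s)"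
  have "t \<cdot> Var(0 := Var 1, 1 := Var 2) =\<^bsub>U\<^esub> v \<cdot> ?q"
  proof -
    have "app2 t (Var 1) (Var 2) = Var (0 :: nat) \<cdot> (\<lambda>_. app2 t (Var 1) (Var 2))" by simp
    also have "\<dots> =\<^bsub>U\<^esub> app2 s e_s (Var 0) \<cdot> (\<lambda>_. app2 t (Var 1) (Var 2))"
      using prov_eq_sym[OF eq_US[OF s_unit[of 0]]]
      by (rule prov_eq_subst) (intro app2_in_terms tU; simp)
    also have "\<dots> = ?W \<cdot> Var(0 := e_s)"
      using e_s by (simp add: app2_subst[OF s] app2_subst[OF t] constant_subst)
    also have "\<dots> =\<^bsub>U\<^esub> v \<cdot> q \<cdot> Var(0 := e_s)"
      using Wq by (rule prov_eq_subst) (rule terms_US[OF upd_e_s_in_terms])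
    finally have "app2 t (Var 1) (Var 2) =\<^bsub>U\<^esub> v \<cdot> ?q" by (simp only: subst_subst)
    then show ?thesis by (simp add: app2_def)
  qed
  moreover have "?q i \<in> terms S UNIV" if "i \<in> X" for i
    by (rule subst_in_terms[OF q[OF that] upd_e_s_in_terms])
  moreover have "(Var(0 := Var 1, 1 := Var 2)) i \<in> terms S UNIV" for i :: nat by simp
  ultimately have "\<exists>f f' r. t \<cdot> (\<lambda>x. Var (f x)) =\<^bsub>T\<^esub> v \<cdot> (\<lambda>x. Var (f' x)) \<and>
      (\<forall>i \<in> {0, 1}. (Var(0 := Var 1, 1 := Var 2)) i =\<^bsub>S\<^esub> r (f i)) \<and> (\<forall>i \<in> X. ?q i =\<^bsub>S\<^esub> r (f' i))"
    by (intro separated_unique[OF t _ v])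
  then obtain f f' r where ff': "t \<cdot> (\<lambda>x. Var (f x)) =\<^bsub>T\<^esub> v \<cdot> (\<lambda>x. Var (f' x))"
    and r01: "Var 1 =\<^bsub>S\<^esub> r (f 0)" "Var 2 =\<^bsub>S\<^esub> r (f 1)"
    and r': "\<And>i. i \<in> X \<Longrightarrow> ?q i =\<^bsub>S\<^esub> r (f' i)"
    by auto
  have "f 0 \<noteq> f 1"
  proof
    assume "f 0 = f 1"
    then have "Var 1 =\<^bsub>S\<^esub> Var 2" using r01 prov_eq_sym[OF r01(2)] by (auto intro: prov_eq_trans)
    then show False using Var_eq_S by fastforce
  qed
  have tf: "t \<cdot> (\<lambda>x. Var (f x)) = app2 t (Var (f 0)) (Var (f 1))"
    using t by (auto simp: app2_def terms_def intro!: subst_cong)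
  \<comment> \<open>With \<open>e_t\<close> for \<open>f 1\<close> the left side of
    \<open>ff'\<close> collapses to \<open>f 0\<close>. By (T3) no other variable is left on the
    right, so any other value of \<open>f' i\<close> must have been \<open>f 1\<close>.\<close>
  have f': "f' i \<in> {f 0, f 1}" if "i \<in> vars v" for i
  proof -
    have "t \<cdot> (\<lambda>x. Var (f x)) \<cdot> Var(f 1 := e_t) =\<^bsub>T\<^esub> v \<cdot> (\<lambda>x. Var (f' x)) \<cdot> Var(f 1 := e_t)"
      using ff' by (rule prov_eq_subst) (rule upd_e_t_in_terms)
    then have "v \<cdot> (\<lambda>x. Var (f' x)) \<cdot> Var(f 1 := e_t) =\<^bsub>T\<^esub> Var (f 0)"
      unfolding tf using prov_eq_trans[OF prov_eq_sym t_unit(1)[of "f 0"]] \<open>f 0 \<noteq> f 1\<close>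
      by (simp add: app2_subst[OF t])
    then have "vars (v \<cdot> (\<lambda>x. Var (f' x)) \<cdot> Var(f 1 := e_t)) \<subseteq> {f 0}"
      by (intro T3 subst_in_terms[of _ T UNIV] subst_in_terms[OF v] upd_e_t_in_terms) auto
    then show ?thesis using that by (fastforce simp: vars_subst split: if_splits)
  qed
  have q01: "?q i =\<^bsub>S\<^esub> Var (if f' i = f 0 then 1 else 2)" if "i \<in> vars v" for i
    using vX f'[OF that] that
      prov_eq_trans[OF r'[of i], of "Var 1"] prov_eq_sym[OF r01(1)]
      prov_eq_trans[OF r'[of i], of "Var 2"] prov_eq_sym[OF r01(2)] by auto
  have c: "?c a \<in> terms S UNIV" for a by (intro app2_in_terms s) auto
  have W_e_t: "v \<cdot> q \<cdot> Var(b := e_t) =\<^bsub>U\<^esub> ?c a" if "(a, b) \<in> {(1, 2), (2, 1)}" for a b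
  proof -
    have "?W \<cdot> Var(b := e_t) =\<^bsub>U\<^esub> v \<cdot> q \<cdot> Var(b := e_t)"
      using Wq by (rule prov_eq_subst) (rule terms_UT[OF upd_e_t_in_terms])
    moreover have "?W \<cdot> Var(b := e_t) =\<^bsub>U\<^esub> ?c a"
      using that eq_UT[OF t_unit(1)] eq_UT[OF t_unit(2)]
      by (auto simp: app2_subst[OF s] app2_subst[OF t]
          intro!: prov_eq_app2[OF sU] prov_eq_refl[of _ _ UNIV])
    ultimately show ?thesis by (rule prov_eq_trans[OF prov_eq_sym])
  qed
  \<comment> \<open>Here \<open>a\<close> is the variable among \<open>1\<close>, \<open>2\<close>
    to which component \<open>i\<close> reduces, and \<open>b\<close> is the other one.\<close>
  have qc: "q i =\<^bsub>S\<^esub> ?c (if f' i = f 0 then 1 else 2)" if "i \<in> vars v" for i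
  proof (rule component_eq[OF v q c W_e_t])
    show "(if f' i = f 0 then 1 else 2, if f' i = f 0 then 2 else 1) \<in> {(1, 2), (2, 1)}" by simp
    show "q i \<cdot> Var(0 := e_s) =\<^bsub>S\<^esub> Var (if f' i = f 0 then 1 else 2)" by (rule q01[OF that])
    show "q j \<cdot> Var(0 := e_s) =\<^bsub>S\<^esub> Var (if f' i = f 0 then 1 else 2) \<or>
        q j \<cdot> Var(0 := e_s) =\<^bsub>S\<^esub> Var (if f' i = f 0 then 2 else 1)" if "j \<in> vars v" for j
      using q01[OF that] by (auto split: if_splits)
  qed (use that in auto)
  \<comment> \<open>Up to equality in \<open>S\<close> the components of \<open>v\<close> factor
    through \<open>f'\<close> by \<open>?\<rho>\<close>, so \<open>ff'\<close> can replace
    \<open>v\<close> by \<open>t\<close>.\<close>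
  let ?\<rho> = "\<lambda>y. ?c (if y = f 0 then 1 else 2)"
  note Wq
  also have "v \<cdot> q =\<^bsub>U\<^esub> v \<cdot> (\<lambda>i. ?\<rho> (f' i))"
    by (rule prov_eq_subst_cong[OF terms_UT[OF v]]) (rule eq_US[OF qc])
  also have "v \<cdot> (\<lambda>i. ?\<rho> (f' i)) = v \<cdot> (\<lambda>x. Var (f' x)) \<cdot> ?\<rho>" by (simp add: subst_subst)
  also have "\<dots> =\<^bsub>U\<^esub> t \<cdot> (\<lambda>x. Var (f x)) \<cdot> ?\<rho>"
    using eq_UT[OF prov_eq_sym[OF ff']] by (rule prov_eq_subst) (rule terms_US[OF c])
  also have "\<dots> = app2 t (?c 1) (?c 2)"
    unfolding tf using \<open>f 0 \<noteq> f 1\<close> by (simp add: app2_subst[OF t])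
  finally have *: "?W =\<^bsub>U\<^esub> app2 t (?c 1) (?c 2)" .
  have "?W \<cdot> (\<lambda>i. [p, a, b] ! i) =\<^bsub>U\<^esub> app2 t (?c 1) (?c 2) \<cdot> (\<lambda>i. [p, a, b] ! i)"
  proof (rule prov_eq_subst[OF *])
    \<comment> \<open>List lookup is unspecified beyond the three entries, so the variables must be
      confined to \<open>0\<close>, \<open>1\<close>, \<open>2\<close>.\<close>
    have "vars (app2 t (?c 1) (?c 2)) \<union> vars ?W \<subseteq> {0, 1, 2}"
      using app2_in_terms[OF tU app2_in_terms[OF sU] app2_in_terms[OF sU],
            of "Var 0" "{0, 1, 2}" "Var 1" "Var 0" "Var 2"]
          app2_in_terms[OF sU _ app2_in_terms[OF tU],
            of "Var 0" "{0, 1, 2}" "Var 1" "Var 2"] by (auto simp: terms_def)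
    then show "[p, a, b] ! i \<in> terms U UNIV"
      if "i \<in> vars ?W \<union> vars (app2 t (?c 1) (?c 2))" for i
      using that pab by (auto simp: numeral_2_eq_2 dest!: subsetD)
  qed
  then show ?thesis by (simp add: app2_subst[OF s] app2_subst[OF t])
qed

section \<open>The abides equation\<close>

text \<open>Both expansions have the same \<open>T\<close>-part \<open>quad Var\<close>, with
  components \<open>\<sigma>\<close> and \<open>\<sigma>\<close> after \<open>\<pi>\<close>.
  Uniqueness yields renamings \<open>f\<close> and \<open>f'\<close>. The four components differ,
  which makes \<open>f\<close> injective, and \<open>f'\<close> is then shown to be \<open>f\<close>
  after \<open>\<pi>\<close> on the four indices.\<close>

lemma abides:
  assumes s: "s \<in> terms S {0, 1}" and t: "t \<in> terms T {0, 1}"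
    and s_unit: "\<And>x. app2 s (Var x) e_s =\<^bsub>S\<^esub> Var x" "\<And>x. app2 s e_s (Var x) =\<^bsub>S\<^esub> Var x"
    and t_unit: "\<And>x. app2 t (Var x) e_t =\<^bsub>T\<^esub> Var x" "\<And>x. app2 t e_t (Var x) =\<^bsub>T\<^esub> Var x"
  obtains f :: "nat \<Rightarrow> nat" where "inj_on f {..<4}"
    "app2 t (app2 t (Var (f 0)) (Var (f 1))) (app2 t (Var (f 2)) (Var (f 3))) =\<^bsub>T\<^esub>
     app2 t (app2 t (Var (f 0)) (Var (f 2))) (app2 t (Var (f 1)) (Var (f 3)))"
proof -
  note sU = terms_US[OF s] and tU = terms_UT[OF t]
  \<comment> \<open>Exchanging the arguments of \<open>s\<close> turns distributivity on one side
    into distributivity on the other.\<close>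
  define s' where "s' = app2 s (Var 1) (Var 0)"
  have s': "s' \<in> terms S {0, 1}" unfolding s'_def by (intro app2_in_terms s) auto
  have app2_s': "app2 s' a b = app2 s b a" for a b
    using app2_subst[OF s] unfolding s'_def app2_def[of "app2 s (Var 1) (Var 0)"] by simp
  note left = distributive[OF s t s_unit(2) t_unit]
  note right = distributive[OF s' t _ t_unit, unfolded app2_s', OF s_unit(1)]
  define quad where "quad g = app2 t (app2 t (g 0) (g 1)) (app2 t (g 2) (g 3))"
    for g :: "nat \<Rightarrow> ('o, nat) trm"
  have quad_subst: "quad g \<cdot> \<sigma> = quad (\<lambda>i. g i \<cdot> \<sigma>)" for g \<sigma>
    by (simp add: quad_def app2_subst[OF t])
  have quad_Var: "quad Var \<in> terms T {..<4}"
    unfolding quad_def by (intro app2_in_terms t) auto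
  \<comment> \<open>The index \<open>i\<close> encodes an entry of a 2 by 2 array:
    \<open>i mod 2\<close> selects from \<open>t(0, 1)\<close> and \<open>2 + i div 2\<close> from
    \<open>t(2, 3)\<close>. The permutation \<open>\<pi>\<close> is transposition of the
    array.\<close>
  define \<sigma> where "\<sigma> i = app2 s (Var (i mod 2)) (Var (2 + i div 2))" for i :: nat
  define \<pi> where "\<pi> = (\<lambda>i. i)(1 := 2, 2 := 1 :: nat)"
  have \<sigma>: "\<sigma> i \<in> terms S UNIV" for i
    unfolding \<sigma>_def by (intro app2_in_terms s) auto
  have "quad \<sigma> =\<^bsub>U\<^esub> app2 s (app2 t (Var 0) (Var 1)) (app2 t (Var 2) (Var 3))"
  proof (rule prov_eq_sym, rule prov_eq_trans[OF left])
    show "app2 t (app2 s (app2 t (Var 0) (Var 1)) (Var 2)) (app2 s (app2 t (Var 0) (Var 1)) (Var 3))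
        =\<^bsub>U\<^esub> quad \<sigma>"
      unfolding quad_def \<sigma>_def by (simp, intro prov_eq_app2[OF tU] right) auto
  qed (auto intro!: app2_in_terms tU)
  also have "\<dots> =\<^bsub>U\<^esub> quad (\<lambda>i. \<sigma> (\<pi> i))"
  proof (rule prov_eq_trans[OF right])
    show "app2 t (app2 s (Var 0) (app2 t (Var 2) (Var 3))) (app2 s (Var 1) (app2 t (Var 2) (Var 3)))
        =\<^bsub>U\<^esub> quad (\<lambda>i. \<sigma> (\<pi> i))"
      unfolding quad_def \<sigma>_def \<pi>_def by (simp, intro prov_eq_app2[OF tU] left) auto
  qed (auto intro!: app2_in_terms tU)
  finally have "quad Var \<cdot> \<sigma> =\<^bsub>U\<^esub> quad Var \<cdot> (\<lambda>i. \<sigma> (\<pi> i))"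
    by (simp add: quad_subst)
  then obtain f f' r
    where ff': "quad Var \<cdot> (\<lambda>x. Var (f x)) =\<^bsub>T\<^esub> quad Var \<cdot> (\<lambda>x. Var (f' x))"
    and "\<forall>i \<in> {..<4}. \<sigma> i =\<^bsub>S\<^esub> r (f i)" "\<forall>i \<in> {..<4}. \<sigma> (\<pi> i) =\<^bsub>S\<^esub> r (f' i)"
    using separated_unique[OF quad_Var _ quad_Var, of \<sigma> "\<lambda>i. \<sigma> (\<pi> i)"] \<sigma> by blast
  then have r: "\<sigma> i =\<^bsub>S\<^esub> r (f i)" and r': "\<sigma> (\<pi> i) =\<^bsub>S\<^esub> r (f' i)" if "i < 4" for i
    using that by auto
  have ff'': "quad (\<lambda>x. Var (f x)) =\<^bsub>T\<^esub> quad (\<lambda>x. Var (f' x))"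
    using ff' by (simp add: quad_subst)
  \<comment> \<open>Putting \<open>e_s\<close> for the second argument recovers
    \<open>i mod 2\<close>, and for the first argument \<open>i div 2\<close>.\<close>
  have \<sigma>_inj: "i = j" if "\<sigma> i =\<^bsub>S\<^esub> \<sigma> j" for i j
  proof -
    have "\<sigma> i \<cdot> (\<lambda>x. if x < 2 then Var x else e_s) =\<^bsub>S\<^esub> \<sigma> j \<cdot> (\<lambda>x. if x < 2 then Var x else e_s)"
      using that e_s by (auto intro!: prov_eq_subst intro: constant_in_terms)
    then have "Var (i mod 2) =\<^bsub>S\<^esub> Var (j mod 2)"
      using prov_eq_trans[OF prov_eq_sym[OF s_unit(1)] prov_eq_trans[OF _ s_unit(1)]]
      unfolding \<sigma>_def by (simp add: app2_subst[OF s])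
    moreover have "\<sigma> i \<cdot> (\<lambda>x. if x < 2 then e_s else Var x) =\<^bsub>S\<^esub> \<sigma> j \<cdot> (\<lambda>x. if x < 2 then e_s else Var x)"
      using that e_s by (auto intro!: prov_eq_subst intro: constant_in_terms)
    then have "Var (2 + i div 2) =\<^bsub>S\<^esub> Var (2 + j div 2)"
      using prov_eq_trans[OF prov_eq_sym[OF s_unit(2)] prov_eq_trans[OF _ s_unit(2)]]
      unfolding \<sigma>_def by (simp add: app2_subst[OF s])
    ultimately have "i mod 2 = j mod 2" "i div 2 = j div 2"
      using Var_eq_S by fastforce+
    then show ?thesis by (metis div_mult_mod_eq)
  qed
  have f_inj: "inj_on f {..<4}"
  proof (rule inj_onI)
    fix i j assume "i \<in> {..<4}" "j \<in> {..<4}" "f i = f j"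
    then show "i = j"
      using prov_eq_trans[OF r[of i], of "\<sigma> j"] prov_eq_sym[OF r[of j]] by (intro \<sigma>_inj) simp
  qed
  have f_f': "i = \<pi> j" if "f i = f' j" "i < 4" "j < 4" for i j
    using prov_eq_trans[OF r[of i], of "\<sigma> (\<pi> j)"] prov_eq_sym[OF r'[of j]] that
    by (intro \<sigma>_inj) simp
  have t_unit': "app2 t u e_t =\<^bsub>T\<^esub> u" "app2 t e_t u =\<^bsub>T\<^esub> u" if "u \<in> terms T UNIV" for u
    using prov_eq_subst[OF t_unit(1)[of 0], of "\<lambda>_. u"]
      prov_eq_subst[OF t_unit(2)[of 0], of "\<lambda>_. u"] that e_t
    by (simp_all add: app2_subst[OF t] constant_subst)
  \<comment> \<open>\<open>r\<close> need not be injective, so \<open>r (f i) = r (f' (\<pi> i))\<close> does not suffice: if \<open>f i\<close> did not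
    occur on the right, putting \<open>e_t\<close> for all other variables would make a closed term equal to a
    variable.\<close>
  have f'_\<pi>: "f' (\<pi> i) = f i" if i: "i < 4" for i
  proof (rule ccontr)
    assume ne: "f' (\<pi> i) \<noteq> f i"
    have nf': "f' j \<noteq> f i" if "j < 4" for j
      using f_f'[of i j] ne that i by (auto simp: \<pi>_def split: if_splits)
    let ?\<rho> = "\<lambda>y. if y = f i then Var y else e_t"
    have \<rho>: "?\<rho> y \<in> terms T UNIV" for y using e_t by (auto intro: constant_in_terms)
    have *: "quad (\<lambda>x. ?\<rho> (f x)) =\<^bsub>T\<^esub> quad (\<lambda>x. ?\<rho> (f' x))"
      using prov_eq_subst[OF ff'', of ?\<rho>] \<rho> by (simp add: quad_subst)
    have "quad (\<lambda>x. ?\<rho> (f' x)) = quad (\<lambda>_. e_t)"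
      using nf' by (simp add: quad_def)
    moreover have "quad (\<lambda>x. ?\<rho> (f x)) =\<^bsub>T\<^esub> Var (f i)"
    proof -
      have fj: "f j = f i \<longleftrightarrow> j = i" if "j < 4" for j
        using f_inj that i by (auto dest: inj_onD)
      have ee: "app2 t e_t e_t =\<^bsub>T\<^esub> e_t" using t_unit' e_t by (auto intro: constant_in_terms)
      have "quad (\<lambda>x. ?\<rho> (f x)) = quad (\<lambda>x. if x = i then Var (f i) else e_t)"
        unfolding quad_def using fj by simp
      moreover have "i \<in> {0, 1, 2, 3}" using i by auto
      \<comment> \<open>There is one case for each position of the surviving variable: its pair
        collapses to it, the other pair to \<open>e_t\<close> by \<open>ee\<close>, and the outer
        unit law finishes.\<close>
      then have "quad (\<lambda>x. if x = i then Var (f i) else e_t) =\<^bsub>T\<^esub> Var (f i)"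
        unfolding quad_def
        using prov_eq_trans[OF prov_eq_app2[OF t t_unit(1) ee] t_unit(1), of "f i"]
          prov_eq_trans[OF prov_eq_app2[OF t t_unit(2) ee] t_unit(1), of "f i"]
          prov_eq_trans[OF prov_eq_app2[OF t ee t_unit(1)] t_unit(2), of "f i"]
          prov_eq_trans[OF prov_eq_app2[OF t ee t_unit(2)] t_unit(2), of "f i"]
        by auto
      ultimately show ?thesis by simp
    qed
    ultimately have "quad (\<lambda>_. e_t) =\<^bsub>T\<^esub> Var (f i)" 
      using prov_eq_trans[OF prov_eq_sym[OF *]] by simp
    moreover have "quad (\<lambda>_. e_t) \<in> terms T {}"
      unfolding quad_def using e_t by (intro app2_in_terms t constant_in_terms)
    ultimately show False
      using T2[of "quad (\<lambda>_. e_t)" "Var (f i)"] by (auto simp: terms_def)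
  qed
  have "f' 0 = f 0" "f' 1 = f 2" "f' 2 = f 1" "f' 3 = f 3"
    using f'_\<pi>[of 0] f'_\<pi>[of 1] f'_\<pi>[of 2] f'_\<pi>[of 3] by (auto simp: \<pi>_def)
  then show ?thesis using that[OF f_inj] ff'' by (simp add: quad_def)
qed

end

section \<open>Non-existence of the composite theory\<close>

theorem theorem4p16:
  fixes S T :: "'o alg_theory" and s t e_s e_t :: "('o, nat) trm"
  assumes "algebraic_theory S" and "algebraic_theory T"
    and S1: "\<forall>s' \<in> terms S UNIV. \<forall>s'' \<in> terms S UNIV. \<forall>\<Gamma>.
               vars s' \<subseteq> {} \<and> \<Gamma> \<turnstile> s' \<approx>\<^bsub>S\<^esub> s'' \<longrightarrow> vars s'' \<subseteq> {}"
    and S2: "\<forall>s' \<in> terms S UNIV. \<forall>x \<Gamma>. \<Gamma> \<turnstile> s' \<approx>\<^bsub>S\<^esub> Var x \<longrightarrow> vars s' \<subseteq> {x}"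
    and S4: "\<forall>s' \<in> terms S UNIV. vars s' \<noteq> {} \<longrightarrow>
               (\<exists>f. (\<forall>x \<in> vars s'. f x \<in> terms S UNIV) \<and>
                    (\<forall>x \<in> vars s'. s' \<cdot> f(x := Var x) =\<^bsub>S\<^esub> Var x))"
    and T2: "\<forall>t' \<in> terms T UNIV. \<forall>t'' \<in> terms T UNIV. \<forall>\<Gamma>.
               vars t' \<subseteq> {} \<and> \<Gamma> \<turnstile> t' \<approx>\<^bsub>T\<^esub> t'' \<longrightarrow> vars t'' \<subseteq> {}"
    and T3: "\<forall>t' \<in> terms T UNIV. \<forall>x \<Gamma>. \<Gamma> \<turnstile> t' \<approx>\<^bsub>T\<^esub> Var x \<longrightarrow> vars t' \<subseteq> {x}"
    and T4: "\<exists>e\<^sub>T. is_constant T e\<^sub>T"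
    and "s \<in> terms S {0, 1}" and "t \<in> terms T {0, 1}"
    and "is_constant S e_s" and "is_constant T e_t"
    and "\<forall>x. app2 s (Var x) e_s =\<^bsub>S\<^esub> Var x \<and> Var x =\<^bsub>S\<^esub> app2 s e_s (Var x)"
    and "\<forall>x. app2 t (Var x) e_t =\<^bsub>T\<^esub> Var x \<and> Var x =\<^bsub>T\<^esub> app2 t e_t (Var x)"
    and no_abides: "\<forall>\<Gamma> x y z w.
          \<Gamma> \<turnstile> app2 t (app2 t (Var x) (Var y)) (app2 t (Var z) (Var w))
              \<approx>\<^bsub>T\<^esub> app2 t (app2 t (Var x) (Var z)) (app2 t (Var y) (Var w))
          \<longrightarrow> card {x, y, z, w} \<le> 3"
  shows "\<not> (\<exists>U :: 'o alg_theory. composite_theory U T S)"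
proof
  assume "\<exists>U :: 'o alg_theory. composite_theory U T S"
  then obtain U :: "'o alg_theory" where "composite_theory U T S" ..
  interpret composite S T U e_s e_t
  proof
    show "vars u \<subseteq> {x}" if "u \<in> terms S UNIV" "u =\<^bsub>S\<^esub> Var x" for u x
      using that S2 unfolding prov_eq_def by blast
    show "vars v = {}"
      if "u \<in> terms T UNIV" "v \<in> terms T UNIV" "vars u = {}" "u =\<^bsub>T\<^esub> v" for u v
      using that T2 unfolding prov_eq_def by blast
    show "vars u \<subseteq> {x}" if "u \<in> terms T UNIV" "u =\<^bsub>T\<^esub> Var x" for u x
      using that T3 unfolding prov_eq_def by blast
  qed fact+
  have s_unit: "app2 s (Var x) e_s =\<^bsub>S\<^esub> Var x" "app2 s e_s (Var x) =\<^bsub>S\<^esub> Var x" for x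
    using assms(13) prov_eq_sym by blast+
  have t_unit: "app2 t (Var x) e_t =\<^bsub>T\<^esub> Var x" "app2 t e_t (Var x) =\<^bsub>T\<^esub> Var x" for x
    using assms(14) prov_eq_sym by blast+
  obtain f :: "nat \<Rightarrow> nat" where f: "inj_on f {..<4}"
    and eq: "app2 t (app2 t (Var (f 0)) (Var (f 1))) (app2 t (Var (f 2)) (Var (f 3))) =\<^bsub>T\<^esub>
     app2 t (app2 t (Var (f 0)) (Var (f 2))) (app2 t (Var (f 1)) (Var (f 3)))"
    using abides[OF assms(9,10) s_unit t_unit] .
  \<comment> \<open>The abides equation just obtained bounds the number of distinct values by three,
    while injectivity of \<open>f\<close> gives four.\<close>
  have "card {f 0, f 1, f 2, f 3} \<le> 3"
    using no_abides eq unfolding prov_eq_def by blast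
  moreover have "{f 0, f 1, f 2, f 3} = f ` {..<4}"
    by (auto simp: numeral_eq_Suc lessThan_Suc)
  ultimately show False using card_image[OF f] by simp
qed

end
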